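(* Let $K$ be a field of characteristic zero, $a\ge2$ an integer, and let $F\in K[[q]]$ satisfy $F(q)=1+f_pq^p+O(q^{p+1})$, where $p\ge1$ and $f_p\ne0$. Then for every $m\ge1$, $$C_m(q)=-f_p(1+f_p)^{m-1}q^{p(a(m-1)+1)}+O\!\left(q^{p(a(m-1)+1)+1}\right),$$ and for every $d\ge2$, $$P_d(q)-T(q)=-f_p(1+f_p)^{d-1}q^{(p+1)(a(d-1)+1)}+O\!\left(q^{(p+1)(a(d-1)+1)+1}\right).$$ If $f_p\ne-1$, the displayed leading coefficients are nonzero.
   Context: For $F(q)=1+\sum_{n\ge1}f_nq^n\in K[[q]]$ and an integer $a\ge2$, define $C_m(q)\in K[[q]]$ by $$\frac{\sum_{m\ge0}X^mF(q^{am+1})}{\sum_{m\ge0}X^mF(q^{a(m+1)})}=\sum_{m\ge0}C_m(q)X^m\quad\text{in }K[[q]][[X]],$$ and for $d\ge1$ $$P_d(q)=q^{1-a}\sum_{j\ge0}C_{jd}(q)q^{ajd},\qquad T(q)=q^{1-a}\frac{F(q)}{F(q^a)}.$$ $O(q^n)$ means divisible by $q^n$ as a formal power series. *)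

theory Defs
  imports "HOL-Computational_Algebra.Computational_Algebra"
begin

definition subst_pow :: "'a::field_char_0 fps \<Rightarrow> nat \<Rightarrow> 'a fps" where
  "subst_pow F k = F oo (fps_X ^ k)"

text \<open>
  The type \<open>'a fps fps\<close> plays the role of $K[[q]][[X]]$: the inner variable is $q$, the
  outer one is $X$.
\<close>

definition numer_series :: "'a::field_char_0 fps \<Rightarrow> nat \<Rightarrow> 'a fps fps" where
  "numer_series F a = Abs_fps (\<lambda>m. subst_pow F (a * m + 1))"

definition denom_series :: "'a::field_char_0 fps \<Rightarrow> nat \<Rightarrow> 'a fps fps" where
  "denom_series F a = Abs_fps (\<lambda>m. subst_pow F (a * (m + 1)))"

definition C_coeff :: "'a::field_char_0 fps \<Rightarrow> nat \<Rightarrow> nat \<Rightarrow> 'a fps" where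
  "C_coeff F a m = fps_nth (numer_series F a / denom_series F a) m"

text \<open>
  The factor $q^{1-a}$ has a negative exponent, so \<open>P_series\<close> and \<open>T_series\<close> are Laurent series.  The infinite
  sum is taken in $K[[q]]$ with its $q$-adic topology.
\<close>

definition P_series :: "'a::field_char_0 fps \<Rightarrow> nat \<Rightarrow> nat \<Rightarrow> 'a fls" where
  "P_series F a d = fls_X_intpow (1 - int a) *
     fps_to_fls (\<Sum>j. C_coeff F a (j * d) * fps_X ^ (a * j * d))"

definition T_series :: "'a::field_char_0 fps \<Rightarrow> nat \<Rightarrow> 'a fls" where
  "T_series F a = fls_X_intpow (1 - int a) * fps_to_fls (F / subst_pow F a)"

definition O_q :: "nat \<Rightarrow> 'a::field_char_0 fps set" where
  "O_q n = {G. fps_X ^ n dvd G}"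

text \<open>
  Division on \<open>'a fps fps\<close> is a total operation, as is \<open>suminf\<close>; the next two facts confirm that
  both have their intended meaning here.
\<close>

lemma numer_eq_C_times_denom:
  assumes "fps_nth F 0 = 1" and "a \<ge> 1"
  shows "Abs_fps (C_coeff F a) * denom_series F a = numer_series F a"
proof -
  let ?N = "numer_series F a" and ?D = "denom_series F a"
  have D0: "fps_nth ?D 0 = subst_pow F a"
    by (simp add: denom_series_def)
  have c: "fps_nth (subst_pow F a) 0 = 1"
    using assms by (simp add: subst_pow_def fps_compose_nth)
  have nz: "fps_nth ?D 0 \<noteq> 0" using D0 c by auto
  then have sd: "subdegree ?D = 0" by (rule subdegree_eq_0)
  have uf: "unit_factor ?D = ?D" using sd by simp
  have "fps_nth ?D 0 * inverse (fps_nth ?D 0) = 1"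
    using D0 c by (simp add: inverse_mult_eq_1')
  then have "?D * inverse ?D = 1"
    by (simp add: fps_inverse_def fps_right_inverse)
  moreover have "Abs_fps (C_coeff F a) = ?N * inverse ?D"
    by (simp add: fps_eq_iff C_coeff_def fps_divide_def sd uf)
  ultimately show ?thesis by (simp add: mult.assoc mult.commute[of "inverse ?D"])
qed

lemma P_series_summable:
  assumes "a \<ge> 1" and "d \<ge> 1"
  shows "summable (\<lambda>j. C_coeff F a (j * d) * fps_X ^ (a * j * d))"
proof -
  let ?f = "\<lambda>j. C_coeff F a (j * d) * fps_X ^ (a * j * d)"
  let ?S = "Abs_fps (\<lambda>n. fps_nth (\<Sum>j<Suc n. ?f j) n)"
  have z: "fps_nth (?f j) n = 0" if "n < j" for j n
  proof -
    have "j * 1 \<le> j * (a * d)" using assms by (intro mult_le_mono2) simp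
    then have "n < j * (a * d)" using that by linarith
    then have "n < a * j * d" by (simp add: mult_ac)
    then show ?thesis by (simp add: fps_X_power_mult_right_nth)
  qed
  have "(\<lambda>N. \<Sum>j<N. ?f j) \<longlonglongrightarrow> ?S"
  proof (rule tendsto_fpsI)
    fix n
    have "fps_nth (\<Sum>j<N. ?f j) n = fps_nth ?S n" if "N \<ge> Suc n" for N
    proof -
      have "(\<Sum>j<N. fps_nth (?f j) n) = (\<Sum>j<Suc n. fps_nth (?f j) n)"
        by (rule sum.mono_neutral_right) (use that z in auto)
      then show ?thesis by (simp add: fps_sum_nth)
    qed
    then show "eventually (\<lambda>N. fps_nth (\<Sum>j<N. ?f j) n = fps_nth ?S n) sequentially"
      using eventually_sequentially by blast
  qed
  then show ?thesis by (auto simp: summable_def sums_def)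
qed

end

theory Submission
  imports Defs
begin

text \<open>
  Multiplying numerator and denominator by $1 - X$ replaces their coefficients by the differences
  $F(q^{k+l}) - F(q^k) = -f_p q^{pk} + \cdots$.  Comparing coefficients of $X^m$ gives a recursion
  for $C_m$ in which the term $C_0$ only contributes in higher order, while all other terms have
  the same leading exponent $p(a(m-1)+1)$; their leading coefficients form a geometric sum.
  In $P_d - T$ the term $j = 0$ cancels and $j = 1$ dominates.
\<close>

section \<open>Leading terms of power series\<close>

text \<open>This encodes \<open>G = c q^n + O(q^(n+1))\<close>. As \<open>c\<close> may be 0, terms
  of higher order enter a sum with coefficient 0, and \<open>f = -1\<close> needs no separate
  case.\<close>

definition has_lead :: "'a::field_char_0 fps \<Rightarrow> nat \<Rightarrow> 'a \<Rightarrow> bool" where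
  "has_lead G n c \<longleftrightarrow> (\<forall>k<n. fps_nth G k = 0) \<and> fps_nth G n = c"

lemma O_q_iff: "G \<in> O_q n \<longleftrightarrow> (\<forall>k<n. fps_nth G k = 0)"
proof
  assume "G \<in> O_q n"
  then show "\<forall>k<n. fps_nth G k = 0"
    by (auto simp: O_q_def dvd_def fps_X_power_mult_nth)
next
  assume "\<forall>k<n. fps_nth G k = 0"
  then have "G = fps_X ^ n * fps_shift n G"
    by (auto simp: fps_eq_iff fps_X_power_mult_nth)
  then show "G \<in> O_q n"
    unfolding O_q_def by (metis (mono_tags) dvd_triv_left mem_Collect_eq)
qed

lemma has_lead_iff_O_q: "has_lead G n c \<longleftrightarrow> G - fps_const c * fps_X ^ n \<in> O_q (n + 1)"
  by (auto simp: has_lead_def O_q_iff less_Suc_eq fps_X_power_nth)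

lemma has_lead_mono: "has_lead G n c \<Longrightarrow> m < n \<Longrightarrow> has_lead G m 0"
  by (simp add: has_lead_def)

lemma has_lead_diff: "has_lead G n c \<Longrightarrow> has_lead H n d \<Longrightarrow> has_lead (G - H) n (c - d)"
  by (simp add: has_lead_def)

lemma has_lead_sum:
  "(\<And>i. i \<in> A \<Longrightarrow> has_lead (G i) n (c i)) \<Longrightarrow> has_lead (\<Sum>i\<in>A. G i) n (\<Sum>i\<in>A. c i)"
  by (simp add: has_lead_def fps_sum_nth)

text \<open>Factoring out \<open>q^n\<close> and \<open>q^m\<close> leaves cofactors with constant
  terms \<open>c\<close> and \<open>d\<close>.\<close>

lemma has_lead_mult:
  assumes "has_lead G n c" and "has_lead H m d"
  shows "has_lead (G * H) (n + m) (c * d)"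
proof -
  have G: "G = fps_X ^ n * fps_shift n G" and H: "H = fps_X ^ m * fps_shift m H"
    using assms by (auto simp: fps_eq_iff fps_X_power_mult_nth has_lead_def)
  have "G * H = fps_X ^ (n + m) * (fps_shift n G * fps_shift m H)"
    by (subst G, subst H) (simp add: power_add mult_ac)
  then show ?thesis
    using assms by (simp add: has_lead_def fps_X_power_mult_nth)
qed

text \<open>The inverse of \<open>U\<close> again has constant term 1. This removes the factor
  \<open>F(q^a)\<close> from the recursion for \<open>C_m\<close>.\<close>

lemma has_lead_mult_cancel:
  assumes "has_lead (G * U) n c" and "fps_nth U 0 = 1"
  shows "has_lead G n c"
proof -
  have "has_lead (inverse U) 0 1"
    using assms(2) by (simp add: has_lead_def)
  from has_lead_mult[OF assms(1) this] have "has_lead (G * U * inverse U) n c"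
    by simp
  moreover have "G * U * inverse U = G"
    using assms(2) inverse_mult_eq_1'[of U] by (simp add: mult.assoc)
  ultimately show ?thesis by simp
qed

lemma has_lead_fps_X_power: "has_lead (fps_X ^ n) n 1"
  by (simp add: has_lead_def fps_X_power_nth)

section \<open>The substitution of \<open>q^k\<close> for \<open>q\<close>\<close>

lemma subst_pow_nth:
  "k \<ge> 1 \<Longrightarrow> fps_nth (subst_pow F k) n = (if k dvd n then fps_nth F (n div k) else 0)"
  by (simp add: subst_pow_def fps_nth_compose_X_power)

lemma subst_pow_nth_0: "k \<ge> 1 \<Longrightarrow> fps_nth (subst_pow F k) 0 = fps_nth F 0"
  by (simp add: subst_pow_nth)

lemma has_lead_subst_pow:
  assumes "k \<ge> 1" and "has_lead G p c"
  shows "has_lead (subst_pow G k) (p * k) c"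
proof -
  have "fps_nth (subst_pow G k) n = 0" if "n < p * k" for n
    using that assms by (auto simp: subst_pow_nth has_lead_def less_mult_imp_div_less)
  then show ?thesis
    using assms by (simp add: subst_pow_nth has_lead_def)
qed

text \<open>The constant terms cancel, and \<open>F(q^l) - 1\<close> starts only at
  \<open>q^(pl)\<close>, beyond \<open>q^(pk)\<close>. So \<open>-F(q^k)\<close> alone supplies the
  leading term.\<close>

lemma has_lead_subst_pow_diff:
  assumes "has_lead (F - 1) p f" and "k \<ge> 1" and "k < l" and "p \<ge> 1"
  shows "has_lead (subst_pow F l - subst_pow F k) (p * k) (- f)"
proof -
  have one: "subst_pow (F - 1) j = subst_pow F j - 1" for j
    by (simp add: subst_pow_def fps_compose_sub_distrib)
  have "has_lead (subst_pow (F - 1) l) (p * k) 0"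
    using has_lead_mono[OF has_lead_subst_pow[OF _ assms(1)]] assms by simp
  from has_lead_diff[OF this has_lead_subst_pow[OF assms(2,1)]] show ?thesis
    by (simp add: one)
qed

section \<open>Recursion and leading term for \<open>C_m\<close>\<close>

lemma C_coeff_convolution:
  assumes "fps_nth F 0 = 1" and "a \<ge> 1"
  shows "(\<Sum>i\<le>m. C_coeff F a i * subst_pow F (a * (m - i + 1))) = subst_pow F (a * m + 1)"
  using arg_cong[OF numer_eq_C_times_denom[OF assms], of "\<lambda>G. fps_nth G m"]
  by (simp add: fps_mult_nth denom_series_def numer_series_def atMost_atLeast0)

lemma C_coeff_0:
  assumes "fps_nth F 0 = 1" and "a \<ge> 1"
  shows "C_coeff F a 0 = F / subst_pow F a"
proof -
  have "C_coeff F a 0 * subst_pow F a = F"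
    using C_coeff_convolution[OF assms, of 0] by (simp add: subst_pow_def)
  moreover have "subst_pow F a \<noteq> 0"
    using subst_pow_nth_0[of a F] assms by auto
  ultimately show ?thesis
    by (metis nonzero_mult_div_cancel_right)
qed

text \<open>Subtract the convolution identity at \<open>m\<close> from the one at
  \<open>Suc m\<close>; the summand of index \<open>Suc m\<close> becomes the left-hand
  side.\<close>

lemma C_coeff_recursion:
  assumes "fps_nth F 0 = 1" and "a \<ge> 1"
  shows "C_coeff F a (Suc m) * subst_pow F a =
    subst_pow F (a * Suc m + 1) - subst_pow F (a * m + 1)
    - (\<Sum>i\<le>m. C_coeff F a i * (subst_pow F (a * (m - i + 2)) - subst_pow F (a * (m - i + 1))))"
proof -
  have "(\<Sum>i\<le>m. C_coeff F a i * subst_pow F (a * (Suc m - i + 1))) =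
        (\<Sum>i\<le>m. C_coeff F a i * subst_pow F (a * (m - i + 2)))"
    by (intro sum.cong) (auto simp: Suc_diff_le)
  then show ?thesis
    using C_coeff_convolution[OF assms, of "Suc m"] C_coeff_convolution[OF assms, of m]
    by (simp add: algebra_simps sum_subtractf)
qed

text \<open>Strong induction along the recursion. Indices start at \<open>Suc 0\<close> because
  \<open>C_0 = F(q)/F(q^a)\<close> has constant term 1 and does not fit the pattern.\<close>

lemma has_lead_C_coeff:
  fixes F :: "'a::field_char_0 fps"
  assumes "has_lead (F - 1) p f" and "a \<ge> 2" and "p \<ge> 1"
  shows "has_lead (C_coeff F a (Suc m)) (p * (a * m + 1)) (- f * (1 + f) ^ m)"
proof (induction m rule: less_induct)
  case (less m)
  have F0: "fps_nth F 0 = 1"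
    using assms(1,3) by (simp add: has_lead_def)
  let ?D = "\<lambda>i. subst_pow F (a * (m - i + 2)) - subst_pow F (a * (m - i + 1))"
  let ?n = "p * (a * m + 1)"
  have D: "has_lead (?D i) (p * (a * (m - i + 1))) (- f)" for i
    using assms by (intro has_lead_subst_pow_diff) auto
  \<comment> \<open>The difference \<open>?D 0\<close> starts at \<open>q^(pa(m+1))\<close>, and
    \<open>a(m+1) > am + 1\<close> because \<open>a\<close> exceeds 1.\<close>
  have zero: "has_lead (C_coeff F a 0 * ?D 0) ?n 0"
  proof -
    have "has_lead (C_coeff F a 0) 0 (fps_nth (C_coeff F a 0) 0)"
      by (simp add: has_lead_def)
    moreover have "?n < 0 + p * (a * (m - 0 + 1))"
      unfolding add_0 diff_zero distrib_left[of a] using assms(2,3) by (intro mult_less_mono2) auto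
    ultimately show ?thesis
      using has_lead_mult[OF _ D[of 0]] has_lead_mono by blast
  qed
  \<comment> \<open>The exponents add up to \<open>p(ai + 1) + pa(m - i) = p(am + 1)\<close>,
    independently of \<open>i\<close>, and the two factors \<open>-f\<close> give the
    square.\<close>
  have pos: "has_lead (C_coeff F a (Suc i) * ?D (Suc i)) ?n (f\<^sup>2 * (1 + f) ^ i)" if i: "i < m" for i
  proof -
    \<comment> \<open>Writing \<open>m\<close> as a sum eliminates the truncated subtraction from
      the exponent identity.\<close>
    obtain k where k: "m = Suc i + k"
      using i less_iff_Suc_add[of i m] by auto
    have "p * (a * i + 1) + p * (a * (m - Suc i + 1)) = ?n"
      by (simp add: k algebra_simps)
    then show ?thesis
      using has_lead_mult[OF less[OF i] D[of "Suc i"]]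
      by (simp only: power2_eq_square mult_minus_left mult_minus_right minus_minus mult_ac)
  qed
  have "has_lead (subst_pow F (a * Suc m + 1) - subst_pow F (a * m + 1)) ?n (- f)"
    using assms by (intro has_lead_subst_pow_diff) auto
  moreover have "has_lead (\<Sum>i\<le>m. C_coeff F a i * ?D i) ?n (\<Sum>i<m. f\<^sup>2 * (1 + f) ^ i)"
  proof -
    have "has_lead (\<Sum>i<m. C_coeff F a (Suc i) * ?D (Suc i)) ?n (\<Sum>i<m. f\<^sup>2 * (1 + f) ^ i)"
      using pos by (intro has_lead_sum) auto
    moreover have "(\<Sum>i\<le>m. C_coeff F a i * ?D i) =
        C_coeff F a 0 * ?D 0 + (\<Sum>i<m. C_coeff F a (Suc i) * ?D (Suc i))"
      by (rule sum.atMost_shift)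
    ultimately show ?thesis
      using zero by (simp add: has_lead_def)
  qed
  ultimately have "has_lead (C_coeff F a (Suc m) * subst_pow F a) ?n
      (- f - (\<Sum>i<m. f\<^sup>2 * (1 + f) ^ i))"
    using has_lead_diff C_coeff_recursion[OF F0, of a m] assms(2) by fastforce
  \<comment> \<open>The geometric sum formula has the factor \<open>(1 + f) - 1 = f\<close>, which
    absorbs one \<open>f\<close> without any division.\<close>
  moreover have "(\<Sum>i<m. f\<^sup>2 * (1 + f) ^ i) = f * ((1 + f) ^ m - 1)"
    using power_diff_1_eq[of "1 + f" m]
    by (simp add: sum_distrib_left power2_eq_square mult.assoc)
  ultimately have "has_lead (C_coeff F a (Suc m) * subst_pow F a) ?n (- f * (1 + f) ^ m)"
    by (simp add: algebra_simps)
  then show ?case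
    by (rule has_lead_mult_cancel) (use assms F0 in \<open>simp add: subst_pow_nth_0\<close>)
qed

section \<open>The infinite sum in \<open>P_d\<close>\<close>

text \<open>In the \<open>q\<close>-adic topology each coefficient of the partial sums is eventually
  constant, and from \<open>N\<close> on no summand changes coefficient \<open>n\<close>.\<close>

lemma fps_nth_suminf:
  fixes g :: "nat \<Rightarrow> 'a::field_char_0 fps"
  assumes "summable g" and "\<And>j. j \<ge> N \<Longrightarrow> fps_nth (g j) n = 0"
  shows "fps_nth (suminf g) n = (\<Sum>j<N. fps_nth (g j) n)"
proof -
  have "eventually (\<lambda>M. fps_nth (\<Sum>j<M. g j) n = fps_nth (suminf g) n) sequentially"
    using summable_LIMSEQ[OF assms(1)] by (simp add: tendsto_fps_iff)
  then obtain M where M: "\<And>M'. M' \<ge> M \<Longrightarrow> fps_nth (\<Sum>j<M'. g j) n = fps_nth (suminf g) n"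
    by (auto simp: eventually_sequentially)
  have "fps_nth (suminf g) n = (\<Sum>j<max M N. fps_nth (g j) n)"
    using M[of "max M N"] by (simp add: fps_sum_nth)
  also have "\<dots> = (\<Sum>j<N. fps_nth (g j) n)"
    by (rule sum.mono_neutral_right) (use assms(2) in auto)
  finally show ?thesis .
qed

text \<open>With \<open>d = Suc e\<close>, subtracting \<open>C_0\<close> removes the summand
  \<open>j = 0\<close>, and all summands with \<open>j\<close> at least 2 start beyond the leading
  exponent of \<open>j = 1\<close>. The factor \<open>q^(1-a)\<close> is still left out.\<close>

lemma has_lead_P_sum:
  fixes F :: "'a::field_char_0 fps"
  assumes "has_lead (F - 1) p f" and "a \<ge> 2" and "p \<ge> 1"
  shows "has_lead ((\<Sum>j. C_coeff F a (j * Suc e) * fps_X ^ (a * j * Suc e)) - C_coeff F a 0)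
    (p * (a * e + 1) + a * Suc e) (- f * (1 + f) ^ e)"
proof -
  let ?g = "\<lambda>j. C_coeff F a (j * Suc e) * fps_X ^ (a * j * Suc e)"
  let ?n = "p * (a * e + 1) + a * Suc e"
  \<comment> \<open>The index \<open>Suc j * Suc e\<close> equals
    \<open>Suc (e + j * Suc e)\<close>, the form needed for the leading term of
    \<open>C_m\<close>.\<close>
  have lead: "has_lead (?g (Suc j)) (p * (a * (e + j * Suc e) + 1) + a * Suc j * Suc e)
      (- f * (1 + f) ^ (e + j * Suc e))" for j
    using has_lead_mult[OF has_lead_C_coeff[OF assms, of "e + j * Suc e"]
        has_lead_fps_X_power[of "a * Suc j * Suc e"]]
    by (simp add: add_ac)
  \<comment> \<open>The exponent from \<open>C_coeff\<close> is at least that for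
    \<open>j = 1\<close>; the factor \<open>q^(ajd)\<close> makes the total strictly larger.\<close>
  have high: "fps_nth (?g j) k = 0" if "2 \<le> j" and k: "k \<le> ?n" for j k
  proof -
    from \<open>2 \<le> j\<close> obtain i where j: "j = Suc (Suc i)"
      by (auto dest: le_Suc_ex)
    have "p * (a * e + 1) \<le> p * (a * (e + Suc i * Suc e) + 1)"
      by (intro mult_le_mono2 add_le_mono1) (rule le_add1)
    moreover have "a * Suc e < a * Suc (Suc i) * Suc e"
      by (rule mult_strict_right_mono) (use assms(2) in auto)
    ultimately have "?n < p * (a * (e + Suc i * Suc e) + 1) + a * Suc (Suc i) * Suc e"
      by (rule add_le_less_mono)
    with k have "k < p * (a * (e + Suc i * Suc e) + 1) + a * Suc (Suc i) * Suc e"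
      by (rule le_less_trans)
    then show ?thesis
      using lead[of "Suc i"] unfolding has_lead_def j by blast
  qed
  have "fps_nth (suminf ?g - C_coeff F a 0) k = fps_nth (?g 1) k" if "k \<le> ?n" for k
  proof -
    have "fps_nth (suminf ?g) k = (\<Sum>j<2. fps_nth (?g j) k)"
    proof (rule fps_nth_suminf)
      show "summable ?g"
        using assms(2) by (intro P_series_summable) auto
    qed (rule high[OF _ that])
    then show ?thesis
      by (simp add: numeral_2_eq_2)
  qed
  then show ?thesis
    using lead[of 0] by (simp add: has_lead_def)
qed

section \<open>The factor \<open>q^(1-a)\<close> and Laurent series\<close>

text \<open>A possibly negative power of \<open>q\<close> is absorbed by \<open>q^n\<close> as long
  as the total exponent is a natural number, so the product is again a power series.\<close>

lemma fls_X_intpow_mult_fps_to_fls: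
  fixes G :: "'a::field_char_0 fps"
  assumes "int m = int n + k"
  shows "fls_X_intpow k * fps_to_fls (fps_X ^ n * G) = fps_to_fls (fps_X ^ m * G)"
proof -
  have "fls_X_intpow k * fls_X ^ n = (fls_X ^ m :: 'a fls)"
    using assms by (simp add: fls_X_power_conv_shift_1 fls_X_intpow_times_fls_X_intpow add.commute)
  then show ?thesis
    by (simp only: fls_times_fps_to_fls fps_to_fls_power fps_X_to_fls mult.assoc[symmetric])
qed

text \<open>The error term is an image under \<open>fps_to_fls\<close>, so the claim includes that
  no negative powers of \<open>q\<close> remain in the difference.\<close>

lemma P_series_minus_T_series:
  fixes F :: "'a::field_char_0 fps"
  assumes "has_lead (F - 1) p f" and "a \<ge> 2" and "p \<ge> 1"
  shows "P_series F a (Suc e) - T_series F a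
      - fps_to_fls (fps_const (- f * (1 + f) ^ e) * fps_X ^ ((p + 1) * (a * e + 1)))
    \<in> fps_to_fls ` O_q ((p + 1) * (a * e + 1) + 1)"
proof -
  let ?S = "\<Sum>j. C_coeff F a (j * Suc e) * fps_X ^ (a * j * Suc e)"
  let ?c = "fps_const (- f * (1 + f) ^ e)"
  define n where "n = p * (a * e + 1) + a * Suc e"
  define m where "m = (p + 1) * (a * e + 1)"
  have F0: "fps_nth F 0 = 1"
    using assms(1,3) by (simp add: has_lead_def)
  \<comment> \<open>Indeed \<open>p(ae + 1) + a(e + 1) + 1 - a = (p + 1)(ae + 1)\<close>.\<close>
  have nm: "int m = int n + (1 - int a)"
    by (simp add: n_def m_def algebra_simps)
  obtain H where "?S - C_coeff F a 0 - ?c * fps_X ^ n = fps_X ^ (n + 1) * H"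
    using has_lead_P_sum[OF assms, of e] unfolding has_lead_iff_O_q O_q_def n_def by (auto elim: dvdE)
  then have S: "?S - F / subst_pow F a = fps_X ^ n * ?c + fps_X ^ (n + 1) * H"
    using C_coeff_0[OF F0, of a] assms(2) by (simp add: algebra_simps)
  have "P_series F a (Suc e) - T_series F a
      = fls_X_intpow (1 - int a) * fps_to_fls (?S - F / subst_pow F a)"
    by (simp only: P_series_def T_series_def fps_to_fls_minus right_diff_distrib)
  also have "\<dots> = fls_X_intpow (1 - int a) * fps_to_fls (fps_X ^ n * (?c + fps_X * H))"
    unfolding S by (simp only: distrib_left power_add power_one_right mult.assoc)
  also have "\<dots> = fps_to_fls (fps_X ^ m * (?c + fps_X * H))"
    by (rule fls_X_intpow_mult_fps_to_fls[OF nm])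
  also have "fps_X ^ m * (?c + fps_X * H) = ?c * fps_X ^ m + fps_X ^ (m + 1) * H"
    by (simp only: distrib_left power_add power_one_right mult.assoc mult.commute[of _ ?c])
  finally have "P_series F a (Suc e) - T_series F a - fps_to_fls (?c * fps_X ^ m)
      = fps_to_fls (fps_X ^ (m + 1) * H)"
    by (simp only: add_diff_cancel_left' flip: fps_to_fls_minus)
  moreover have "fps_X ^ (m + 1) * H \<in> O_q (m + 1)"
    unfolding O_q_def by simp
  ultimately show ?thesis
    unfolding m_def by blast
qed

theorem theorem2p2:
  fixes F :: "'a::field_char_0 fps" and f :: 'a and a p :: nat
  assumes "a \<ge> 2" and "p \<ge> 1" and "f \<noteq> 0"
    and "F - (1 + fps_const f * fps_X ^ p) \<in> O_q (p + 1)"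
  shows
    "(\<forall>m\<ge>1.
        C_coeff F a m - fps_const (- f * (1 + f) ^ (m - 1)) * fps_X ^ (p * (a * (m - 1) + 1))
          \<in> O_q (p * (a * (m - 1) + 1) + 1)) \<and>
     (\<forall>d\<ge>2.
        P_series F a d - T_series F a
          - fps_to_fls (fps_const (- f * (1 + f) ^ (d - 1)) * fps_X ^ ((p + 1) * (a * (d - 1) + 1)))
          \<in> fps_to_fls ` O_q ((p + 1) * (a * (d - 1) + 1) + 1)) \<and>
     (f \<noteq> - 1 \<longrightarrow>
        (\<forall>m\<ge>1. - f * (1 + f) ^ (m - 1) \<noteq> 0) \<and>
        (\<forall>d\<ge>2. - f * (1 + f) ^ (d - 1) \<noteq> 0))"
proof (intro conjI allI impI)
  have F: "has_lead (F - 1) p f"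
    using assms(4) by (simp add: has_lead_iff_O_q diff_diff_eq)
  show "C_coeff F a m - fps_const (- f * (1 + f) ^ (m - 1)) * fps_X ^ (p * (a * (m - 1) + 1))
      \<in> O_q (p * (a * (m - 1) + 1) + 1)" if "m \<ge> 1" for m
    using has_lead_C_coeff[OF F assms(1,2), of "m - 1"] that
    unfolding has_lead_iff_O_q by simp
  show "P_series F a d - T_series F a
      - fps_to_fls (fps_const (- f * (1 + f) ^ (d - 1)) * fps_X ^ ((p + 1) * (a * (d - 1) + 1)))
      \<in> fps_to_fls ` O_q ((p + 1) * (a * (d - 1) + 1) + 1)" if "d \<ge> 2" for d
    using P_series_minus_T_series[OF F assms(1,2), of "d - 1"] that by simp
  have "- f * (1 + f) ^ k \<noteq> 0" if "f \<noteq> - 1" for k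
    using that assms(3) by (simp add: add_eq_0_iff)
  \<comment> \<open>The claims for \<open>m\<close> and for \<open>d\<close> are both instances of
    the preceding fact and coincide up to the name of the variable.\<close>
  then show "- f * (1 + f) ^ (m - 1) \<noteq> 0" "- f * (1 + f) ^ (m - 1) \<noteq> 0" if "f \<noteq> - 1" for m
    using that by blast+
qed

end
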